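(* Consider the problem and Algorithm CLVR described in the context, let $(x^*,y^* )$ be a primal-dual solution, and let $\tilde x_k=\frac1{A_k}\sum_{i=1}^ka_ix_i$. Then for all $k\ge1$, $\tilde x_k$ satisfies $$\mathbb E\big[\|y^*\|\cdot\|A\tilde x_k-b\|\big]\le\frac{\gamma\|x^*-x_0\|^2+\frac1{2\gamma}\|y^*-y_0\|^2+\frac1\gamma\mathbb E[\|v-y_0\|^2]}{A_k},$$ $$\big|\mathbb E\big[(c^T\tilde x_k+r(\tilde x_k))-(c^Tx^*+r(x^* ))\big]\big|\le\frac{\gamma\|x^*-x_0\|^2+\frac1{2\gamma}\|y^*-y_0\|^2+\frac1\gamma\mathbb E[\|v-y_0\|^2]}{A_k},$$ where $v=2\frac{\|y^*\|}{\|A\tilde x_k-b\|}(A\tilde x_k-b)$ (with $v=0$ if $A\tilde x_k=b$), and expectations are over all the randomness of the algorithm.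
   Context: Setting. $\mathcal X\subseteq\mathbb R^d$ is closed and convex, $c\in\mathbb R^d$, $A\in\mathbb R^{n\times d}$, $b\in\mathbb R^n$, and $r:\mathbb R^d\to\mathbb R$ is convex. The generalized linear program is $\min_x\{c^Tx+r(x):Ax=b,\ x\in\mathcal X\}$, with primal-dual form $\min_{x\in\mathcal X}\max_{y\in\mathbb R^n}\mathcal L(x,y)$, $\mathcal L(x,y)=c^Tx+r(x)+y^TAx-y^Tb$. A primal-dual solution (Nash point) is $(x^*,y^* )\in\mathcal X\times\mathbb R^n$ with $\mathcal L(x^*,y)\le\mathcal L(x^*,y^* )\le\mathcal L(x,y^* )$ for all $x\in\mathcal X,y\in\mathbb R^n$; it is assumed that at least one exists. It is assumed that $r$ is $\sigma$-strongly convex with $\sigma\ge0$: for all $x_1,x_2\in\mathcal X$ and every subgradient $r'(x_2)\in\partial r(x_2)$, $r(x_1)\ge r(x_2)+\langle r'(x_2),x_1-x_2\rangle+\frac\sigma2\|x_1-x_2\|^2$. The index set $[n]=\{1,\dots,n\}$ is partitioned into nonempty blocks $S^1,\dots,S^m$; $A^{S^j}$ is the submatrix of rows of $A$ indexed by $S^j$, $A^{S^j,T}$ denotes its transpose, and $y^{S^j},b^{S^j}$ are the corresponding subvectors. $\hat L=\max_{j\in[m]}\|A^{S^j}\|>0$ (spectral norm). $\|\cdot\|$ is the Euclidean norm for vectors. For convex $\phi$, $\mathrm{prox}_\phi(\hat x)=\arg\min_{x\in\mathcal X}\{\frac12\|x-\hat x\|^2+\phi(x)\}$. Algorithm CLVR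 (run for $K\ge k$ iterations). Input: $x_0\in\mathcal X$, $y_0\in\mathbb R^n$, $z_0=A^Ty_0$, $\gamma>0$, $\hat L$, $\sigma$, $K$, $m$, $S^1,\dots,S^m$. Set $a_1=A_1=\frac1{2\hat Lm}$, $q_0=a_1(z_0+c)$. For $k=1,\dots,K$: (1) $x_k=\mathrm{prox}_{\frac1\gamma A_kr}(x_0-\frac1\gamma q_{k-1})$; (2) pick $j_k$ uniformly at random in $[m]$ (independently of the past); (3) $y_k^{S^{j_k}}=y_{k-1}^{S^{j_k}}+\gamma ma_k(A^{S^{j_k}}x_k-b^{S^{j_k}})$, and $y_k^{S^i}=y_{k-1}^{S^i}$ for $i\ne j_k$; (4) $a_{k+1}=\frac{\sqrt{1+\sigma A_k/\gamma}}{2\hat Lm}$, $A_{k+1}=A_k+a_{k+1}$; (5) $z_k=z_{k-1}+A^{S^{j_k},T}(y_k^{S^{j_k}}-y_{k-1}^{S^{j_k}})$; (6) $q_k=q_{k-1}+a_{k+1}(z_k+c)+ma_k(z_k-z_{k-1})$. *)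

theory Defs
  imports "HOL-Analysis.Analysis" "HOL-Probability.Probability"
begin

definition subdifferential :: "('a::real_inner \<Rightarrow> real) \<Rightarrow> 'a \<Rightarrow> 'a set" where
  "subdifferential r x = {g. \<forall>u. r u \<ge> r x + g \<bullet> (u - x)}"

definition strongly_convex_on :: "'a::real_inner set \<Rightarrow> ('a \<Rightarrow> real) \<Rightarrow> real \<Rightarrow> bool" where
  "strongly_convex_on X r \<sigma> \<longleftrightarrow>
     (\<forall>x1\<in>X. \<forall>x2\<in>X. \<forall>g\<in>subdifferential r x2.
        r x1 \<ge> r x2 + g \<bullet> (x1 - x2) + \<sigma> / 2 * (norm (x1 - x2))\<^sup>2)"

definition lagrangian ::
  "real^'d \<Rightarrow> real^'d^'n \<Rightarrow> real^'n \<Rightarrow> (real^'d \<Rightarrow> real) \<Rightarrow> real^'d \<Rightarrow> real^'n \<Rightarrow> real" where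
  "lagrangian c A b r x y = c \<bullet> x + r x + y \<bullet> (A *v x) - y \<bullet> b"

definition nash_point ::
  "(real^'d) set \<Rightarrow> real^'d \<Rightarrow> real^'d^'n \<Rightarrow> real^'n \<Rightarrow> (real^'d \<Rightarrow> real)
    \<Rightarrow> real^'d \<Rightarrow> real^'n \<Rightarrow> bool" where
  "nash_point X c A b r xs ys \<longleftrightarrow> xs \<in> X \<and>
     (\<forall>x\<in>X. \<forall>y. lagrangian c A b r xs y \<le> lagrangian c A b r xs ys \<and>
                lagrangian c A b r xs ys \<le> lagrangian c A b r x ys)"

(* arg_min_on picks some minimiser; for X closed, convex and nonempty and phi convex and
   real-valued on the whole space, the minimiser exists and is unique. *)
definition prox :: "'a::real_normed_vector set \<Rightarrow> ('a \<Rightarrow> real) \<Rightarrow> 'a \<Rightarrow> 'a" where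
  "prox X \<phi> w = arg_min_on (\<lambda>x. 1 / 2 * (norm (x - w))\<^sup>2 + \<phi> x) X"

(* The submatrix of the rows indexed by B, encoded by replacing all other rows by zero: this keeps
   the number of rows fixed and changes neither the spectral norm nor the product of the transpose
   with a vector whose entries are restricted to B. *)
definition row_block :: "'n set \<Rightarrow> real^'d^'n \<Rightarrow> real^'d^'n" where
  "row_block B A = (\<chi> i. if i \<in> B then A $ i else 0)"

definition max_block_norm :: "real^'d^'n \<Rightarrow> nat \<Rightarrow> (nat \<Rightarrow> 'n set) \<Rightarrow> real" where
  "max_block_norm A m S = Max ((\<lambda>j. onorm (\<lambda>x. row_block (S j) A *v x)) ` {1..m})"

(* The recursion is started from A_0 = 0, which reproduces a_1 = A_1 = 1 / (2 L m). *)
primrec step_sum :: "real \<Rightarrow> nat \<Rightarrow> real \<Rightarrow> real \<Rightarrow> nat \<Rightarrow> real" where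
  "step_sum L m \<sigma> \<gamma> 0 = 0"
| "step_sum L m \<sigma> \<gamma> (Suc k) = step_sum L m \<sigma> \<gamma> k
     + sqrt (1 + \<sigma> * step_sum L m \<sigma> \<gamma> k / \<gamma>) / (2 * L * real m)"

definition step_size :: "real \<Rightarrow> nat \<Rightarrow> real \<Rightarrow> real \<Rightarrow> nat \<Rightarrow> real" where
  "step_size L m \<sigma> \<gamma> k = sqrt (1 + \<sigma> * step_sum L m \<sigma> \<gamma> (k - 1) / \<gamma>) / (2 * L * real m)"

lemma step_1:
  "step_size L m \<sigma> \<gamma> 1 = 1 / (2 * L * real m)"
  "step_sum L m \<sigma> \<gamma> 1 = 1 / (2 * L * real m)"
  by (simp_all add: step_size_def)

lemma step_Suc:
  "step_size L m \<sigma> \<gamma> (Suc k) = sqrt (1 + \<sigma> * step_sum L m \<sigma> \<gamma> k / \<gamma>) / (2 * L * real m)"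
  "step_sum L m \<sigma> \<gamma> (Suc k) = step_sum L m \<sigma> \<gamma> k + step_size L m \<sigma> \<gamma> (Suc k)"
  by (simp_all add: step_size_def)

(* The tuple (x_k, y_k, z_k, q_k) after k iterations, when the block picked in iteration i is
   S (js i). *)
primrec clvr ::
  "(real^'d) set \<Rightarrow> real^'d \<Rightarrow> real^'d^'n \<Rightarrow> real^'n \<Rightarrow> (real^'d \<Rightarrow> real)
    \<Rightarrow> real \<Rightarrow> real \<Rightarrow> nat \<Rightarrow> (nat \<Rightarrow> 'n set) \<Rightarrow> real^'d \<Rightarrow> real^'n \<Rightarrow> (nat \<Rightarrow> nat) \<Rightarrow> nat
    \<Rightarrow> (real^'d) \<times> (real^'n) \<times> (real^'d) \<times> (real^'d)" where
  "clvr X c A b r \<sigma> \<gamma> m S x0 y0 js 0 =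
    (let z0 = transpose A *v y0
     in (x0, y0, z0, step_size (max_block_norm A m S) m \<sigma> \<gamma> 1 *\<^sub>R (z0 + c)))"
| "clvr X c A b r \<sigma> \<gamma> m S x0 y0 js (Suc k) =
    (let (x, y, z, q) = clvr X c A b r \<sigma> \<gamma> m S x0 y0 js k;
         a = step_size (max_block_norm A m S) m \<sigma> \<gamma>;
         As = step_sum (max_block_norm A m S) m \<sigma> \<gamma>;
         B = S (js (Suc k));
         x' = prox X (\<lambda>u. 1 / \<gamma> * As (Suc k) * r u) (x0 - (1 / \<gamma>) *\<^sub>R q);
         y' = (\<chi> i. if i \<in> B then y $ i + \<gamma> * real m * a (Suc k) * ((A *v x') $ i - b $ i)
                    else y $ i);
         z' = z + transpose (row_block B A) *v (y' - y);
         q' = q + a (Suc (Suc k)) *\<^sub>R (z' + c) + (real m * a (Suc k)) *\<^sub>R (z' - z)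
     in (x', y', z', q'))"

definition clvr_average ::
  "(real^'d) set \<Rightarrow> real^'d \<Rightarrow> real^'d^'n \<Rightarrow> real^'n \<Rightarrow> (real^'d \<Rightarrow> real)
    \<Rightarrow> real \<Rightarrow> real \<Rightarrow> nat \<Rightarrow> (nat \<Rightarrow> 'n set) \<Rightarrow> real^'d \<Rightarrow> real^'n \<Rightarrow> (nat \<Rightarrow> nat) \<Rightarrow> nat
    \<Rightarrow> real^'d" where
  "clvr_average X c A b r \<sigma> \<gamma> m S x0 y0 js k =
    (1 / step_sum (max_block_norm A m S) m \<sigma> \<gamma> k) *\<^sub>R
    (\<Sum>i=1..k. step_size (max_block_norm A m S) m \<sigma> \<gamma> i *\<^sub>R
              fst (clvr X c A b r \<sigma> \<gamma> m S x0 y0 js i))"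

definition dual_comparator :: "real^'d^'n \<Rightarrow> real^'n \<Rightarrow> real^'n \<Rightarrow> real^'d \<Rightarrow> real^'n" where
  "dual_comparator A b ys x =
    (if A *v x = b then 0 else (2 * norm ys / norm (A *v x - b)) *\<^sub>R (A *v x - b))"

end

theory Submission
  imports Defs
begin

text \<open>
  Fix a saddle point \<open>(xs, ys)\<close>; then \<open>A *v xs = b\<close>. Write \<open>f u = c \<bullet> u + r u\<close>, \<open>gap\<^sub>i v = f x\<^sub>i
  - f xs + (A x\<^sub>i - b) \<bullet> v\<close> for the primal-dual gap of the \<open>i\<close>-th iterate against a dual
  comparator \<open>v\<close>, and \<open>s\<^sub>i = y\<^sub>i - y\<^sub>i\<^sub>-\<^sub>1\<close> for the dual steps. Since \<open>y\<close> moves by \<open>\<gamma> m a\<^sub>i (A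
  x\<^sub>i - b)\<close> in one block only, drawn uniformly from \<open>m\<close> blocks, \<open>s\<^sub>i / \<gamma>\<close> is an unbiased
  estimate of \<open>a\<^sub>i (A x\<^sub>i - b)\<close>; its error is the noise \<open>e\<^sub>i\<close>.

  Every run that only draws blocks from \<open>{1..m}\<close> satisfies (\<open>pathwise_gap_bound\<close>), for all \<open>v\<close>,
  \<open>\<Sum>a\<^sub>i gap\<^sub>i v \<le> \<gamma>/2 |xs - x0|\<^sup>2 + 1/(2\<gamma>) |v - y0|\<^sup>2 + \<Sum>e\<^sub>i \<bullet> (v - y\<^sub>i\<^sub>-\<^sub>1) - 1/(4\<gamma>) \<Sum>|s\<^sub>i|\<^sup>2\<close>.
  This is the dual averaging argument: \<open>x\<^sub>k\<close> minimises an estimate function that is \<open>\<gamma> + \<sigma>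
  A\<^sub>k\<close>-strongly convex. The extrapolation term \<open>m a\<^sub>k (z\<^sub>k - z\<^sub>k\<^sub>-\<^sub>1)\<close> turns the error of using
  the old dual iterate into cross terms between \<open>s\<^sub>k\<close> and \<open>x\<^sub>k\<^sub>+\<^sub>1 - x\<^sub>k\<close>, and the step size is
  chosen so that half of the strong convexity absorbs them (\<open>cross_term_bound\<close>).

  Taking means, \<open>\<Sum>e\<^sub>i \<bullet> (w - y\<^sub>i\<^sub>-\<^sub>1)\<close> vanishes for a fixed \<open>w\<close> (\<open>mean_noise_inner\<close>), and \<open>E
  |\<Sum>e\<^sub>i|\<^sup>2\<close> is at most \<open>1/\<gamma>\<^sup>2 E \<Sum>|s\<^sub>i|\<^sup>2\<close> (\<open>mean_noise_square_le\<close>). The inequality is then used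
  twice. With \<open>v = ys\<close> the gap is nonnegative, which bounds the total dual movement: \<open>1/(4\<gamma>) E
  \<Sum>|s\<^sub>i|\<^sup>2\<close> is at most \<open>\<gamma>/2 |xs - x0|\<^sup>2 + 1/(2\<gamma>) |ys - y0|\<^sup>2\<close> (\<open>mean_dual_movement_le\<close>). With a
  \<open>v\<close> that depends on the run, the term \<open>(\<Sum>e\<^sub>i) \<bullet> (v - y0)\<close> survives; Young's inequality trades
  it for \<open>1/(2\<gamma>) |v - y0|\<^sup>2\<close> and a multiple of the dual movement, which has just been bounded
  (\<open>mean_avg_gap_le\<close>). The movement bound adds \<open>\<gamma>/2 |xs - x0|\<^sup>2\<close> and \<open>1/(2\<gamma>) |ys - y0|\<^sup>2\<close> to the
  right-hand side, Young's inequality doubles the coefficient of \<open>|v - y0|\<^sup>2\<close>, and the result is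
  the bound that is claimed.

  The comparator \<open>v\<close> of length \<open>2 |ys|\<close> along the residual \<open>g\<close> of the averaged iterate makes its
  gap equal to the suboptimality plus \<open>2 |ys| |g|\<close>. The saddle point inequality says that the
  suboptimality is at least \<open>- |ys| |g|\<close>. So the gap dominates \<open>|ys| |g|\<close>, hence the negated
  suboptimality, and it dominates the suboptimality itself (\<open>dual_comparator_gap\<close>).

  Almost surely the run depends on one of finitely many, equally likely, sequences of blocks, so
  all expectations are finite averages (\<open>expectation_eq_draws_mean\<close>), and conditioning on the
  past is averaging over the last block (\<open>draws_mean_Suc\<close>).
\<close>

section \<open>Strong convexity and the proximal step\<close>

text \<open>
  A hyperplane that separates the point \<open>(x, r x)\<close> from the strict epigraph cannot be vertical,
  because \<open>r\<close> is finite on the whole space; its slope is a subgradient.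
\<close>

lemma subdifferential_nonempty:
  fixes r :: "'a::euclidean_space \<Rightarrow> real"
  assumes "convex_on UNIV r"
  shows "subdifferential r x \<noteq> {}"
proof -
  define E where "E = {p :: 'a \<times> real. r (fst p) < snd p}"
  have "convex E"
  proof (rule convexI)
    fix p p' and s t :: real
    assume p: "p \<in> E" "p' \<in> E" and st: "0 \<le> s" "0 \<le> t" "s + t = 1"
    have "r (s *\<^sub>R fst p + t *\<^sub>R fst p') \<le> s * r (fst p) + t * r (fst p')"
      using assms st unfolding convex_on_def by blast
    also have "\<dots> < s * snd p + t * snd p'"
    proof (cases "s = 0")
      case True
      then show ?thesis using p st by (simp add: E_def)
    next
      case False
      then have "s * r (fst p) < s * snd p" "t * r (fst p') \<le> t * snd p'"
        using p st by (auto simp: E_def intro!: mult_left_mono)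
      then show ?thesis by linarith
    qed
    finally show "s *\<^sub>R p + t *\<^sub>R p' \<in> E" by (simp add: E_def)
  qed
  moreover have "(x, r x + 1) \<in> E" by (simp add: E_def)
  then have "E \<noteq> {}" by blast
  moreover have "{(x, r x)} \<inter> E = {}" by (simp add: E_def)
  ultimately have "\<exists>a \<beta>. a \<noteq> 0 \<and> (\<forall>p\<in>{(x, r x)}. a \<bullet> p \<le> \<beta>) \<and> (\<forall>p\<in>E. \<beta> \<le> a \<bullet> p)"
    by (intro separating_hyperplane_sets) auto
  then obtain a \<beta> where a: "a \<noteq> 0" "a \<bullet> (x, r x) \<le> \<beta>" "\<forall>p\<in>E. \<beta> \<le> a \<bullet> p"
    by blast
  obtain g t where gt: "a = (g, t)" by (cases a)
  have sep: "g \<bullet> x + t * r x \<le> g \<bullet> u + t * s" if "r u < s" for u s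
    using a(2) a(3)[rule_format, of "(u, s)"] that by (simp add: gt E_def)
  have "t \<ge> 0"
    using sep[of x "r x + 1"] by (simp add: algebra_simps)
  moreover have "t \<noteq> 0"
  proof
    assume "t = 0"
    then have "g \<bullet> x \<le> g \<bullet> (x - g)" using sep[of "x - g" "r (x - g) + 1"] by simp
    then have "g \<bullet> g \<le> 0" by (simp add: inner_diff_right)
    then have "g \<bullet> g = 0" using inner_ge_zero order_antisym by blast
    then have "g = 0" by simp
    with \<open>t = 0\<close> a(1) gt show False by (simp add: zero_prod_def)
  qed
  ultimately have t: "t > 0" by simp
  have "r x + (- (1 / t) *\<^sub>R g) \<bullet> (u - x) \<le> r u" for u
  proof (rule field_le_epsilon)
    fix e :: real assume "e > 0"
    then have "g \<bullet> x + t * r x \<le> g \<bullet> u + t * (r u + e)" by (intro sep) simp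
    then show "r x + (- (1 / t) *\<^sub>R g) \<bullet> (u - x) \<le> r u + e"
      using t by (simp add: inner_diff_right field_simps)
  qed
  then show ?thesis unfolding subdifferential_def by blast
qed

text \<open>
  The two strong subgradient inequalities at the intermediate point, weighted by \<open>1 - t\<close> and
  \<open>t\<close>, add up to this form, which mentions no subgradients and so needs no calculus of
  subdifferentials.
\<close>

lemma strongly_convex_on_Jensen:
  fixes r :: "'a::euclidean_space \<Rightarrow> real"
  assumes "convex_on UNIV r" and "convex X" and sc: "strongly_convex_on X r \<sigma>"
    and "x \<in> X" "u \<in> X" and t: "0 \<le> t" "t \<le> 1"
  shows "r ((1 - t) *\<^sub>R x + t *\<^sub>R u)
           \<le> (1 - t) * r x + t * r u - \<sigma> / 2 * (t * (1 - t)) * (norm (u - x))\<^sup>2"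
proof -
  define w where "w = (1 - t) *\<^sub>R x + t *\<^sub>R u"
  have "w \<in> X" unfolding w_def using assms by (intro convexD) auto
  obtain g where g: "g \<in> subdifferential r w"
    using subdifferential_nonempty[OF assms(1)] by blast
  have wx: "x - w = (- t) *\<^sub>R (u - x)" and wu: "u - w = (1 - t) *\<^sub>R (u - x)"
    by (simp_all add: w_def algebra_simps)
  have "r w + (- t) * (g \<bullet> (u - x)) + \<sigma> / 2 * (t * norm (u - x))\<^sup>2 \<le> r x"
    using sc \<open>w \<in> X\<close> \<open>x \<in> X\<close> g t unfolding strongly_convex_on_def
    by (metis wx inner_scaleR_right norm_scaleR abs_minus_cancel abs_of_nonneg)
  then have 1: "(1 - t) * (r w + (- t) * (g \<bullet> (u - x)) + \<sigma> / 2 * (t * norm (u - x))\<^sup>2) \<le> (1 - t) * r x"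
    using t by (intro mult_left_mono) auto
  have "r w + (1 - t) * (g \<bullet> (u - x)) + \<sigma> / 2 * ((1 - t) * norm (u - x))\<^sup>2 \<le> r u"
    using sc \<open>w \<in> X\<close> \<open>u \<in> X\<close> g t unfolding strongly_convex_on_def
    by (metis wu inner_scaleR_right norm_scaleR abs_of_nonneg diff_ge_0_iff_ge)
  then have "t * (r w + (1 - t) * (g \<bullet> (u - x)) + \<sigma> / 2 * ((1 - t) * norm (u - x))\<^sup>2) \<le> t * r u"
    using t by (intro mult_left_mono) auto
  moreover have "(1 - t) * (r w + (- t) * (g \<bullet> (u - x)) + \<sigma> / 2 * (t * norm (u - x))\<^sup>2)
      + t * (r w + (1 - t) * (g \<bullet> (u - x)) + \<sigma> / 2 * ((1 - t) * norm (u - x))\<^sup>2)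
      = r w + \<sigma> / 2 * (t * (1 - t)) * (norm (u - x))\<^sup>2"
    by (simp add: field_simps power2_eq_square)
  ultimately show ?thesis unfolding w_def[symmetric] using 1 by linarith
qed

text \<open>
  Existence of the minimiser: a subgradient of \<open>r\<close> bounds it below by an affine function, so the
  objective is coercive and it suffices to minimise over a compact ball. The quadratic growth
  follows by comparing the minimum with the value at points on the segment towards \<open>u\<close> that tend
  to the minimiser.
\<close>

lemma prox_strong_minimiser:
  fixes r :: "'a::euclidean_space \<Rightarrow> real" and w :: 'a
  assumes r: "convex_on UNIV r" and X: "closed X" "convex X" "X \<noteq> {}"
    and sc: "strongly_convex_on X r \<sigma>" and t: "t \<ge> 0"
  defines "p \<equiv> prox X (\<lambda>u. t * r u) w"
  shows "p \<in> X"
    and "u \<in> X \<Longrightarrow> 1 / 2 * (norm (p - w))\<^sup>2 + t * r p + (1 + t * \<sigma>) / 2 * (norm (u - p))\<^sup>2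
                     \<le> 1 / 2 * (norm (u - w))\<^sup>2 + t * r u"
proof -
  define F where "F = (\<lambda>u. 1 / 2 * (norm (u - w))\<^sup>2 + t * r u)"
  obtain p0 where p0: "p0 \<in> X" using X by blast
  obtain g where g: "\<And>u. r w + g \<bullet> (u - w) \<le> r u"
    using subdifferential_nonempty[OF r, of w] unfolding subdifferential_def by blast
  have cont: "continuous_on UNIV F"
    unfolding F_def using convex_on_continuous[OF open_UNIV r] by (intro continuous_intros)
  \<comment> \<open>the affine lower bound shows that the objective exceeds its value at \<open>p0\<close> outside the ball of radius \<open>R\<close>\<close>
  define R where "R = 2 * (t * norm g) + 2 + \<bar>F p0 - t * r w\<bar> + norm (p0 - w)"
  have far: "F p0 < F u" if "norm (u - w) > R" for u
  proof -
    define d where "d = norm (u - w)"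
    have tg: "0 \<le> t * norm g" using t by simp
    have d: "d \<ge> 2" "d - 2 * (t * norm g) \<ge> 2 + \<bar>F p0 - t * r w\<bar>"
      using that tg norm_ge_zero[of "p0 - w"] abs_ge_zero[of "F p0 - t * r w"]
      unfolding d_def[symmetric] R_def by linarith+
    have "\<bar>g \<bullet> (u - w)\<bar> \<le> norm g * d" unfolding d_def by (rule Cauchy_Schwarz_ineq2)
    then have "r w - norm g * d \<le> r u" using g[of u] by linarith
    then have "t * (r w - norm g * d) \<le> t * r u" using t by (rule mult_left_mono)
    moreover have "1 / 2 * (2 * (2 + \<bar>F p0 - t * r w\<bar>)) \<le> 1 / 2 * (d * (d - 2 * (t * norm g)))"
      using d by (intro mult_left_mono mult_mono) auto
    moreover have "F u = 1 / 2 * (d * (d - 2 * (t * norm g))) + t * norm g * d + t * r u"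
      by (simp add: F_def d_def algebra_simps power2_eq_square)
    ultimately show ?thesis
      using abs_ge_self[of "F p0 - t * r w"] by (simp add: algebra_simps)
  qed
  have "compact (X \<inter> cball w R)" using X by (intro closed_Int_compact) auto
  moreover have p0R: "p0 \<in> X \<inter> cball w R"
    using p0 t by (simp add: R_def dist_norm norm_minus_commute)
  ultimately obtain p1 where p1: "p1 \<in> X \<inter> cball w R" "\<And>u. u \<in> X \<inter> cball w R \<Longrightarrow> F p1 \<le> F u"
    using continuous_attains_inf[of "X \<inter> cball w R" F] continuous_on_subset[OF cont] by blast
  have "F p1 \<le> F u" if "u \<in> X" for u
  proof (cases "norm (u - w) \<le> R")
    case True
    then show ?thesis using p1(2)[of u] that by (simp add: dist_norm norm_minus_commute)
  next
    case False
    then show ?thesis using far[of u] p1(2)[OF p0R] by simp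
  qed
  then have min': "\<not> F u < F p1" if "u \<in> X" for u using that by force
  have "p \<in> X \<and> (\<forall>u\<in>X. F p \<le> F u)"
    unfolding p_def prox_def arg_min_on_def F_def[symmetric]
  proof (rule arg_minI[where x = p1])
    show "p1 \<in> X" using p1(1) by blast
    show "\<not> F u < F p1" if "u \<in> X" for u by (rule min'[OF that])
    show "v \<in> X \<and> (\<forall>u\<in>X. F v \<le> F u)" if "v \<in> X" "\<forall>u. u \<in> X \<longrightarrow> \<not> F u < F v" for v
      using that by (simp add: not_less)
  qed
  then have pX: "p \<in> X" and min: "u \<in> X \<Longrightarrow> F p \<le> F u" for u by auto
  show "p \<in> X" by (rule pX)
  assume u: "u \<in> X"
  define D where "D = (norm (u - p))\<^sup>2"
  have "F p + (1 + t * \<sigma>) / 2 * (1 - s) * D \<le> F u" if s: "0 < s" "s < 1" for s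
  proof -
    define v where "v = (1 - s) *\<^sub>R p + s *\<^sub>R u"
    have "v \<in> X" unfolding v_def using X pX u s by (intro convexD) auto
    have "t * r v \<le> t * ((1 - s) * r p + s * r u - \<sigma> / 2 * (s * (1 - s)) * D)"
      unfolding v_def D_def using strongly_convex_on_Jensen[OF r X(2) sc pX u, of s] s t
      by (intro mult_left_mono) auto
    moreover have "(norm (v - w))\<^sup>2 = (1 - s) * (norm (p - w))\<^sup>2 + s * (norm (u - w))\<^sup>2 - s * (1 - s) * D"
      unfolding v_def D_def power2_norm_eq_inner
      by (simp add: algebra_simps inner_commute power2_eq_square)
    ultimately have "F v \<le> (1 - s) * F p + s * F u - (1 + t * \<sigma>) / 2 * (s * (1 - s)) * D"
      by (simp add: F_def algebra_simps add_divide_distrib diff_divide_distrib)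
    with min[OF \<open>v \<in> X\<close>] have "s * (F p + (1 + t * \<sigma>) / 2 * (1 - s) * D) \<le> s * F u"
      by (simp add: algebra_simps)
    then show ?thesis using s by simp
  qed
  then have ev: "\<forall>\<^sub>F s in at_right 0. F p + (1 + t * \<sigma>) / 2 * (1 - s) * D \<le> F u"
    unfolding eventually_at_right_field by (intro exI[of _ 1]) auto
  have "((\<lambda>s. F p + (1 + t * \<sigma>) / 2 * (1 - s) * D) \<longlongrightarrow> F p + (1 + t * \<sigma>) / 2 * (1 - 0) * D) (at_right 0)"
    by (intro tendsto_intros)
  \<comment> \<open>letting \<open>s\<close> tend to \<open>0\<close> recovers the full quadratic growth\<close>
  from tendsto_upperbound[OF this ev] show
    "1 / 2 * (norm (p - w))\<^sup>2 + t * r p + (1 + t * \<sigma>) / 2 * (norm (u - p))\<^sup>2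
      \<le> 1 / 2 * (norm (u - w))\<^sup>2 + t * r u"
    by (simp add: F_def D_def)
qed

section \<open>Expectations over finitely many uniform draws\<close>

text \<open>
  The expectation over \<open>n\<close> independent uniform draws from \<open>{1..m}\<close>, written as a finite average:
  every functional of the draws has one, and conditioning becomes an exchange of finite sums.
\<close>

definition draws_mean :: "nat \<Rightarrow> nat \<Rightarrow> ((nat \<Rightarrow> nat) \<Rightarrow> real) \<Rightarrow> real" where
  "draws_mean m n F = (\<Sum>js\<in>PiE {1..n} (\<lambda>_. {1..m}). F js) / real m ^ n"

text \<open>
  The tower property: the inner average is the conditional expectation given the first \<open>n\<close>
  draws.
\<close>

lemma draws_mean_Suc:
  "draws_mean m (Suc n) F = draws_mean m n (\<lambda>js. (\<Sum>j=1..m. F (js(Suc n := j))) / real m)"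
proof -
  have "PiE {1..Suc n} (\<lambda>_. {1..m})
      = (\<lambda>(j, js). js(Suc n := j)) ` ({1..m} \<times> PiE {1..n} (\<lambda>_. {1..m}))"
    by (simp add: atLeastAtMostSuc_conv PiE_insert_eq)
  then have "(\<Sum>js\<in>PiE {1..Suc n} (\<lambda>_. {1..m}). F js)
      = (\<Sum>p\<in>{1..m} \<times> PiE {1..n} (\<lambda>_. {1..m}). F ((\<lambda>(j, js). js(Suc n := j)) p))"
    by (intro sum.reindex_cong[OF inj_combinator]) auto
  also have "\<dots> = (\<Sum>js\<in>PiE {1..n} (\<lambda>_. {1..m}). \<Sum>j=1..m. F (js(Suc n := j)))"
    by (subst sum.swap) (simp add: sum.cartesian_product split_def)
  finally show ?thesis
    by (simp add: draws_mean_def sum_divide_distrib[symmetric] mult.commute)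
qed

lemma draws_mean_mono:
  assumes "\<And>js. js \<in> PiE {1..n} (\<lambda>_. {1..m}) \<Longrightarrow> F js \<le> G js"
  shows "draws_mean m n F \<le> draws_mean m n G"
  unfolding draws_mean_def by (intro divide_right_mono sum_mono assms) auto

lemma draws_mean_linear:
  "draws_mean m n (\<lambda>js. F js + G js) = draws_mean m n F + draws_mean m n G"
  "draws_mean m n (\<lambda>js. F js - G js) = draws_mean m n F - draws_mean m n G"
  "draws_mean m n (\<lambda>js. t * F js) = t * draws_mean m n F"
  unfolding draws_mean_def
  by (simp_all add: sum.distrib sum_subtractf sum_distrib_left add_divide_distrib diff_divide_distrib)

lemma draws_mean_const: "m > 0 \<Longrightarrow> draws_mean m n (\<lambda>_. t) = t"
  by (simp add: draws_mean_def card_PiE)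

text \<open>
  Up to a null set, the sample space splits into the events on which the first \<open>n\<close> draws are a
  given sequence, and independence gives each of them probability \<open>1 / m ^ n\<close>.
\<close>

lemma (in prob_space) expectation_eq_draws_mean:
  assumes indep: "indep_vars (\<lambda>_. count_space UNIV) J {1..K}"
    and unif: "\<And>i. i \<in> {1..K} \<Longrightarrow>
           distr M (count_space UNIV) (J i) = measure_pmf (pmf_of_set {1..m})"
    and n: "1 \<le> n" "n \<le> K" and "m > 0"
    and dep: "\<And>js js'. (\<And>i. i \<in> {1..n} \<Longrightarrow> js i = js' i) \<Longrightarrow> F js = F js'"
  shows "(\<integral>\<omega>. F (\<lambda>i. J i \<omega>) \<partial>M) = draws_mean m n F"
proof -
  have J: "J i \<in> measurable M (count_space UNIV)" if "i \<in> {1..n}" for i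
    using indep n that unfolding indep_vars_def by auto
  have ne: "finite {1..m}" "{1..m} \<noteq> {}" using \<open>m > 0\<close> by auto
  have prob_eq: "prob (J i -` {j} \<inter> space M) = 1 / real m" if "i \<in> {1..n}" "j \<in> {1..m}" for i j
  proof -
    have "prob (J i -` {j} \<inter> space M) = measure (distr M (count_space UNIV) (J i)) {j}"
      using J[OF that(1)] by (simp add: measure_distr)
    also have "\<dots> = 1 / real m"
      using that n ne by (simp add: unif measure_pmf_single)
    finally show ?thesis .
  qed
  have range: "AE \<omega> in M. \<forall>i\<in>{1..n}. J i \<omega> \<in> {1..m}"
  proof (subst AE_finite_all)
    show "\<forall>i\<in>{1..n}. AE \<omega> in M. J i \<omega> \<in> {1..m}"
    proof
      fix i assume i: "i \<in> {1..n}"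
      then have "i \<in> {1..K}" using n by auto
      then have "AE j in distr M (count_space UNIV) (J i). j \<in> {1..m}"
        unfolding unif[OF \<open>i \<in> {1..K}\<close>] using ne by (simp add: AE_measure_pmf_iff)
      then show "AE \<omega> in M. J i \<omega> \<in> {1..m}" by (rule AE_distrD[OF J[OF i]])
    qed
  qed simp
  define \<Omega> where "\<Omega> = PiE {1..n} (\<lambda>_. {1..m})"
  have fin: "finite \<Omega>" unfolding \<Omega>_def by (intro finite_PiE) auto
  define E where "E = (\<lambda>js. \<Inter>i\<in>{1..n}. J i -` {js i} \<inter> space M)"
  have E: "E js \<in> events" for js
    unfolding E_def using n J by (intro sets.finite_INT) (auto intro!: measurable_sets)
  have prob_E: "prob (E js) = 1 / real m ^ n" if "js \<in> \<Omega>" for js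
  proof -
    have "prob (E js) = (\<Prod>i\<in>{1..n}. prob (J i -` {js i} \<inter> space M))"
      unfolding E_def using n by (intro indep_varsD[OF indep]) auto
    also have "\<dots> = (\<Prod>i\<in>{1..n}. 1 / real m)"
      using that by (intro prod.cong refl prob_eq) (auto simp: \<Omega>_def PiE_iff)
    finally show ?thesis by (simp add: power_one_over)
  qed
  have decomp: "AE \<omega> in M. F (\<lambda>i. J i \<omega>) = (\<Sum>js\<in>\<Omega>. F js * indicator (E js) \<omega>)"
  proof (use range AE_space in eventually_elim)
    case (elim \<omega>)
    define js0 where "js0 = restrict (\<lambda>i. J i \<omega>) {1..n}"
    have js0: "js0 \<in> \<Omega>" using elim by (auto simp: js0_def \<Omega>_def)
    have mem: "\<omega> \<in> E js \<longleftrightarrow> js = js0" if "js \<in> \<Omega>" for js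
    proof
      assume "\<omega> \<in> E js"
      then show "js = js0"
        using that js0 n unfolding \<Omega>_def by (intro PiE_ext) (auto simp: E_def js0_def)
    next
      assume "js = js0"
      then show "\<omega> \<in> E js" using elim n by (auto simp: E_def js0_def)
    qed
    have "(\<Sum>js\<in>\<Omega>. F js * indicator (E js) \<omega>) = (\<Sum>js\<in>\<Omega>. if js = js0 then F js0 else 0)"
      by (intro sum.cong refl) (auto simp: mem indicator_def)
    also have "\<dots> = F js0" using fin js0 by simp
    also have "\<dots> = F (\<lambda>i. J i \<omega>)" by (intro dep) (simp add: js0_def)
    finally show ?case by simp
  qed
  have "(\<lambda>\<omega>. F (\<lambda>i. J i \<omega>)) \<in> borel_measurable M"
  proof -
    have "(\<lambda>\<omega>. restrict (\<lambda>i. J i \<omega>) {1..n}) \<in> measurable M (PiM {1..n} (\<lambda>_. count_space UNIV))"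
      using J by (intro measurable_restrict) auto
    moreover have "F \<in> borel_measurable (PiM {1..n} (\<lambda>_. count_space UNIV))"
      by (subst count_space_PiM_finite) (auto intro: measurable_count_space)
    ultimately have "(\<lambda>\<omega>. F (restrict (\<lambda>i. J i \<omega>) {1..n})) \<in> borel_measurable M"
      by (rule measurable_compose)
    moreover have "F (restrict (\<lambda>i. J i \<omega>) {1..n}) = F (\<lambda>i. J i \<omega>)" for \<omega>
      by (intro dep) simp
    ultimately show ?thesis by simp
  qed
  then have "(\<integral>\<omega>. F (\<lambda>i. J i \<omega>) \<partial>M) = (\<integral>\<omega>. (\<Sum>js\<in>\<Omega>. F js * indicator (E js) \<omega>) \<partial>M)"
    using decomp E by (intro integral_cong_AE) auto
  also have "\<dots> = (\<Sum>js\<in>\<Omega>. F js * prob (E js))"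
    using E by (subst Bochner_Integration.integral_sum)
      (auto intro!: integrable_real_indicator simp: emeasure_eq_measure)
  also have "\<dots> = draws_mean m n F"
    unfolding draws_mean_def \<Omega>_def[symmetric] by (simp add: prob_E sum_divide_distrib)
  finally show ?thesis .
qed

text \<open>
  The mean square of \<open>N\<close> plus centred vectors: the mixed term vanishes and centring does not
  increase second moments. This drives the variance estimate of the martingale below.
\<close>

lemma sum_norm_centred_le:
  fixes N u :: "'a::real_inner"
  assumes "(\<Sum>j\<in>I. d j) = real (card I) *\<^sub>R u"
  shows "(\<Sum>j\<in>I. (norm (N + (u - d j)))\<^sup>2) \<le> (\<Sum>j\<in>I. (norm N)\<^sup>2 + (norm (d j))\<^sup>2)"
proof -
  have "(norm (N + (u - d j)))\<^sup>2 = (norm (N + u))\<^sup>2 - 2 * ((N + u) \<bullet> d j) + (norm (d j))\<^sup>2" for j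
    unfolding power2_norm_eq_inner by (simp add: algebra_simps inner_commute)
  then have "(\<Sum>j\<in>I. (norm (N + (u - d j)))\<^sup>2)
      = real (card I) * (norm (N + u))\<^sup>2 - 2 * ((N + u) \<bullet> (\<Sum>j\<in>I. d j)) + (\<Sum>j\<in>I. (norm (d j))\<^sup>2)"
    by (simp add: sum.distrib sum_subtractf inner_sum_right sum_distrib_left)
  also have "\<dots> = real (card I) * ((norm N)\<^sup>2 - (norm u)\<^sup>2) + (\<Sum>j\<in>I. (norm (d j))\<^sup>2)"
    unfolding assms power2_norm_eq_inner by (simp add: algebra_simps inner_commute)
  also have "\<dots> \<le> real (card I) * (norm N)\<^sup>2 + (\<Sum>j\<in>I. (norm (d j))\<^sup>2)"
    by (intro add_right_mono mult_left_mono) auto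
  finally show ?thesis by (simp add: sum.distrib)
qed

section \<open>Row blocks and the iterates\<close>

definition restrict_rows :: "'n set \<Rightarrow> real^'n \<Rightarrow> real^'n" where
  "restrict_rows B w = (\<chi> i. if i \<in> B then w $ i else 0)"

lemma inner_restrict_rows: "restrict_rows B u \<bullet> w = restrict_rows B u \<bullet> restrict_rows B w"
  unfolding restrict_rows_def inner_vec_def by (auto intro!: sum.cong)

lemma transpose_row_block_restrict_rows:
  "transpose (row_block B A) *v restrict_rows B w = transpose A *v restrict_rows B w"
  unfolding restrict_rows_def row_block_def matrix_vector_mult_def transpose_def vec_eq_iff
  by (auto intro!: sum.cong)

lemma row_block_mult: "row_block B A *v u = restrict_rows B (A *v u)"
  unfolding restrict_rows_def row_block_def matrix_vector_mult_def vec_eq_iff by auto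

lemma transpose_inner: "(transpose A *v w) \<bullet> u = w \<bullet> (A *v (u :: real^'d))" for A :: "real^'d^'n"
  by (simp add: transpose_matrix_vector dot_lmul_matrix)

text \<open>
  The reason why the block update is unbiased.
\<close>

lemma sum_restrict_rows_partition:
  fixes S :: "nat \<Rightarrow> 'n::finite set"
  assumes "disjoint_family_on S {1..m}" and "(\<Union>j\<in>{1..m}. S j) = UNIV"
  shows "(\<Sum>j=1..m. restrict_rows (S j) w) = w"
proof -
  have "(\<Sum>j=1..m. restrict_rows (S j) w $ i) = w $ i" for i
  proof -
    obtain j0 where j0: "j0 \<in> {1..m}" "i \<in> S j0" using assms(2) by blast
    have uniq: "j = j0" if "j \<in> {1..m}" "i \<in> S j" for j
      using assms(1) j0 that unfolding disjoint_family_on_def by blast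
    have "restrict_rows (S j) w $ i = (if j = j0 then w $ i else 0)" if "j \<in> {1..m}" for j
      using uniq[OF that] j0(2) by (cases "i \<in> S j") (simp_all add: restrict_rows_def, blast)
    then have "(\<Sum>j=1..m. restrict_rows (S j) w $ i) = (\<Sum>j=1..m. if j = j0 then w $ i else 0)"
      by (intro sum.cong refl)
    then show ?thesis using j0 by simp
  qed
  then show ?thesis by (simp add: vec_eq_iff)
qed

text \<open>
  The iterates are adapted: the \<open>k\<close>-th one is a function of the first \<open>k\<close> draws.
\<close>

lemma clvr_cong:
  assumes "\<And>i. i \<in> {1..k} \<Longrightarrow> js i = js' i"
  shows "clvr X c A b r \<sigma> \<gamma> m S x0 y0 js k = clvr X c A b r \<sigma> \<gamma> m S x0 y0 js' k"
  using assms
proof (induction k)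
  case 0
  show ?case by simp
next
  case (Suc k)
  have "clvr X c A b r \<sigma> \<gamma> m S x0 y0 js k = clvr X c A b r \<sigma> \<gamma> m S x0 y0 js' k"
    using Suc.prems by (intro Suc.IH) auto
  moreover have "js (Suc k) = js' (Suc k)" using Suc.prems by simp
  ultimately show ?case by simp
qed

locale clvr_problem =
  fixes X :: "(real^'d) set" and c :: "real^'d" and A :: "real^'d^'n" and b :: "real^'n"
    and r :: "real^'d \<Rightarrow> real" and \<sigma> \<gamma> :: real
    and m :: nat and S :: "nat \<Rightarrow> 'n set"
    and x0 xs :: "real^'d" and y0 ys :: "real^'n"
  assumes closed_X: "closed X" and convex_X: "convex X"
    and convex_r: "convex_on UNIV r"
    and sigma_nonneg: "\<sigma> \<ge> 0" and strongly_convex: "strongly_convex_on X r \<sigma>"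
    and blocks_disjoint: "disjoint_family_on S {1..m}"
    and blocks_cover: "(\<Union>j\<in>{1..m}. S j) = UNIV"
    and block_norm_pos: "max_block_norm A m S > 0"
    and saddle_point: "nash_point X c A b r xs ys"
    and x0_in: "x0 \<in> X" and gamma_pos: "\<gamma> > 0"
begin

abbreviation "L \<equiv> max_block_norm A m S"
abbreviation "a \<equiv> step_size L m \<sigma> \<gamma>"
abbreviation "As \<equiv> step_sum L m \<sigma> \<gamma>"

definition "x js k = fst (clvr X c A b r \<sigma> \<gamma> m S x0 y0 js k)"
definition "y js k = fst (snd (clvr X c A b r \<sigma> \<gamma> m S x0 y0 js k))"
definition "z js k = fst (snd (snd (clvr X c A b r \<sigma> \<gamma> m S x0 y0 js k)))"
definition "q js k = snd (snd (snd (clvr X c A b r \<sigma> \<gamma> m S x0 y0 js k)))"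

abbreviation "f u \<equiv> c \<bullet> u + r u"
abbreviation "residual js k \<equiv> A *v x js k - b"

text \<open>
  Truncated subtraction makes the step at index \<open>0\<close> vanish, as needed for the first
  extrapolation term.
\<close>

definition "dual_step js k = y js k - y js (k - 1)"

lemma dual_step_0 [simp]: "dual_step js 0 = 0"
  by (simp add: dual_step_def)

lemma m_pos: "m > 0"
  using blocks_cover by (cases m) auto

lemma step_sum_nonneg: "As k \<ge> 0"
  using sigma_nonneg gamma_pos block_norm_pos by (induction k) auto

lemma step_size_pos: "a k > 0"
  using step_sum_nonneg[of "k - 1"] sigma_nonneg gamma_pos block_norm_pos m_pos
  unfolding step_size_def by (auto intro!: divide_pos_pos add_pos_nonneg)

lemma step_sum_eq: "As k = (\<Sum>i=1..k. a i)"
  by (induction k) (simp_all add: step_Suc(2) del: step_sum.simps(2))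

lemma step_sum_pos: "k \<ge> 1 \<Longrightarrow> As k > 0"
  unfolding step_sum_eq by (intro sum_pos step_size_pos) auto

lemma init: "x js 0 = x0" "y js 0 = y0" "z js 0 = transpose A *v y0"
  "q js 0 = a 1 *\<^sub>R (transpose A *v y0 + c)"
  by (simp_all add: x_def y_def z_def q_def Let_def)

lemma x_Suc: "x js (Suc k) = prox X (\<lambda>u. 1 / \<gamma> * As (Suc k) * r u) (x0 - (1 / \<gamma>) *\<^sub>R q js k)"
  by (simp add: x_def q_def Let_def split: prod.splits)

lemma y_Suc: "y js (Suc k) = y js k
    + (\<gamma> * real m * a (Suc k)) *\<^sub>R restrict_rows (S (js (Suc k))) (residual js (Suc k))"
  by (simp add: x_def y_def Let_def restrict_rows_def vec_eq_iff split: prod.splits)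

lemma dual_step_Suc:
  "dual_step js (Suc k) = (\<gamma> * real m * a (Suc k)) *\<^sub>R restrict_rows (S (js (Suc k))) (residual js (Suc k))"
  by (simp add: dual_step_def y_Suc)

text \<open>
  The recursion for \<open>z\<close> only saves work: its increment involves a single block, but \<open>z\<close> is the
  full product.
\<close>

lemma z_eq: "z js k = transpose A *v y js k"
proof (induction k)
  case 0
  show ?case by (simp add: init)
next
  case (Suc k)
  have "z js (Suc k) = z js k + transpose (row_block (S (js (Suc k))) A) *v dual_step js (Suc k)"
    by (simp add: x_def y_def z_def dual_step_def Let_def split: prod.splits)
  also have "\<dots> = transpose A *v y js k + transpose A *v dual_step js (Suc k)"
    unfolding dual_step_Suc matrix_vector_mult_scaleR transpose_row_block_restrict_rows Suc ..
  finally show ?case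
    unfolding dual_step_def by (simp del: transpose_matrix_vector flip: matrix_vector_right_distrib)
qed

text \<open>
  The linear part of the estimate function that \<open>x\<^sub>k\<close> minimises. The algorithm's \<open>q\<close> is this
  vector shifted by one index; the value \<open>0\<close> at the start makes \<open>x0\<close> the minimiser of the
  initial function.
\<close>

definition "linear_part js k = (case k of 0 \<Rightarrow> 0 | Suc j \<Rightarrow> q js j)"

text \<open>
  One extrapolated dual gradient is added in each iteration. The formula includes the first
  iteration, whose extrapolation term is zero.
\<close>

lemma linear_part_Suc: "linear_part js (Suc k) = linear_part js k
    + a (Suc k) *\<^sub>R (transpose A *v y js k + c) + (real m * a k) *\<^sub>R (transpose A *v dual_step js k)"
proof (cases k)
  case 0
  then show ?thesis by (simp add: linear_part_def init)
next
  case (Suc j)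
  have "q js (Suc j) = q js j + a (Suc (Suc j)) *\<^sub>R (z js (Suc j) + c)
      + (real m * a (Suc j)) *\<^sub>R (z js (Suc j) - z js j)"
    by (simp add: z_def q_def Let_def split: prod.splits)
  with Suc show ?thesis
    by (simp add: linear_part_def z_eq dual_step_def del: transpose_matrix_vector flip: matrix_vector_mult_diff_distrib)
qed

text \<open>
  Completing the square turns the estimate function into \<open>\<gamma>\<close> times the objective of the proximal
  step.
\<close>

lemma x_minimises:
  "x js k \<in> X"
  "u \<in> X \<Longrightarrow> linear_part js k \<bullet> x js k + As k * r (x js k) + \<gamma> / 2 * (norm (x js k - x0))\<^sup>2
      + (\<gamma> + \<sigma> * As k) / 2 * (norm (u - x js k))\<^sup>2
    \<le> linear_part js k \<bullet> u + As k * r u + \<gamma> / 2 * (norm (u - x0))\<^sup>2"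
proof -
  have main: "x js k \<in> X \<and> (u \<in> X \<longrightarrow> linear_part js k \<bullet> x js k + As k * r (x js k)
        + \<gamma> / 2 * (norm (x js k - x0))\<^sup>2 + (\<gamma> + \<sigma> * As k) / 2 * (norm (u - x js k))\<^sup>2
      \<le> linear_part js k \<bullet> u + As k * r u + \<gamma> / 2 * (norm (u - x0))\<^sup>2)" for u
  proof (cases k)
    case 0
    then show ?thesis using x0_in by (simp add: linear_part_def init)
  next
    case (Suc j)
    define w where "w = x0 - (1 / \<gamma>) *\<^sub>R q js j"
    define t where "t = 1 / \<gamma> * As k"
    have t: "t \<ge> 0" using step_sum_nonneg gamma_pos by (simp add: t_def)
    have xk: "x js k = prox X (\<lambda>u. t * r u) w" unfolding Suc x_Suc t_def w_def ..
    have "X \<noteq> {}" using x0_in by blast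
    note prox = prox_strong_minimiser[OF convex_r closed_X convex_X this strongly_convex t, where w = w,
        folded xk]
    have sq: "\<gamma> * (1 / 2 * (norm (v - w))\<^sup>2)
        = linear_part js k \<bullet> v + \<gamma> / 2 * (norm (v - x0))\<^sup>2
          + (1 / (2 * \<gamma>) * (norm (q js j))\<^sup>2 - q js j \<bullet> x0)" for v
    proof -
      have eq: "v - w = (v - x0) + (1 / \<gamma>) *\<^sub>R q js j" by (simp add: w_def)
      have "(norm (v - w))\<^sup>2
          = (norm (v - x0))\<^sup>2 + 2 / \<gamma> * (q js j \<bullet> (v - x0)) + 1 / \<gamma>\<^sup>2 * (norm (q js j))\<^sup>2"
        unfolding power2_norm_eq_inner eq
        by (simp add: inner_add_left inner_add_right inner_commute power2_eq_square)
      then show ?thesis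
        using gamma_pos by (simp add: Suc linear_part_def inner_diff_right field_simps power2_eq_square)
    qed
    have "linear_part js k \<bullet> x js k + As k * r (x js k) + \<gamma> / 2 * (norm (x js k - x0))\<^sup>2
        + (\<gamma> + \<sigma> * As k) / 2 * (norm (u - x js k))\<^sup>2
      \<le> linear_part js k \<bullet> u + As k * r u + \<gamma> / 2 * (norm (u - x0))\<^sup>2" if "u \<in> X"
    proof -
      have tg: "\<gamma> * t = As k" using gamma_pos by (simp add: t_def)
      have "\<gamma> * (1 / 2 * (norm (x js k - w))\<^sup>2 + t * r (x js k)
              + (1 + t * \<sigma>) / 2 * (norm (u - x js k))\<^sup>2)
          \<le> \<gamma> * (1 / 2 * (norm (u - w))\<^sup>2 + t * r u)"
        using prox(2)[where u = u] that gamma_pos by (intro mult_left_mono) auto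
      moreover have "\<gamma> * ((1 + t * \<sigma>) / 2 * (norm (u - x js k))\<^sup>2)
          = (\<gamma> + \<sigma> * (\<gamma> * t)) / 2 * (norm (u - x js k))\<^sup>2"
        by (simp add: field_simps)
      moreover have tr: "\<gamma> * (t * r v) = As k * r v" for v by (simp flip: tg)
      ultimately show ?thesis unfolding distrib_left sq tg tr by linarith
    qed
    moreover have "x js k \<in> X" by (rule prox(1))
    ultimately show ?thesis by blast
  qed
  show "x js k \<in> X" by (rule conjunct1[OF main])
  show "u \<in> X \<Longrightarrow> linear_part js k \<bullet> x js k + As k * r (x js k)
      + \<gamma> / 2 * (norm (x js k - x0))\<^sup>2 + (\<gamma> + \<sigma> * As k) / 2 * (norm (u - x js k))\<^sup>2
    \<le> linear_part js k \<bullet> u + As k * r u + \<gamma> / 2 * (norm (u - x0))\<^sup>2"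
    by (rule conjunct2[OF main, THEN mp])
qed

lemma xs_in: "xs \<in> X"
  using saddle_point by (simp add: nash_point_def)

text \<open>
  Otherwise moving the multiplier along the residual would increase the Lagrangian.
\<close>

lemma xs_feasible: "A *v xs = b"
proof -
  have "lagrangian c A b r xs (ys + (A *v xs - b)) \<le> lagrangian c A b r xs ys"
    using saddle_point unfolding nash_point_def by blast
  then have "(A *v xs - b) \<bullet> (A *v xs - b) \<le> 0"
    by (simp add: lagrangian_def inner_add_left inner_diff_right)
  then have "(A *v xs - b) \<bullet> (A *v xs - b) = 0"
    using inner_ge_zero order_antisym by blast
  then show ?thesis by simp
qed

lemma xs_optimal: "u \<in> X \<Longrightarrow> f xs \<le> f u + ys \<bullet> (A *v u - b)"
  using saddle_point xs_feasible unfolding nash_point_def lagrangian_def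
  by (force simp: inner_diff_right)

lemma residual_eq: "residual js k = A *v (x js k - xs)"
  by (simp add: matrix_vector_mult_diff_distrib xs_feasible)

text \<open>
  A vector supported on one block only sees the rows of that block.
\<close>

lemma inner_block_bound:
  assumes "j \<in> {1..m}"
  shows "\<bar>restrict_rows (S j) w \<bullet> (A *v u)\<bar> \<le> L * norm (restrict_rows (S j) w) * norm u"
proof -
  let ?T = "\<lambda>u. row_block (S j) A *v u"
  have "norm (?T u) \<le> onorm ?T * norm u"
    by (intro onorm matrix_vector_mul_bounded_linear)
  also have "\<dots> \<le> L * norm u"
    unfolding max_block_norm_def using assms by (intro mult_right_mono Max_ge) auto
  finally have T: "norm (?T u) \<le> L * norm u" .
  have "\<bar>restrict_rows (S j) w \<bullet> (A *v u)\<bar> = \<bar>restrict_rows (S j) w \<bullet> ?T u\<bar>"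
    by (subst inner_restrict_rows) (simp add: row_block_mult)
  also have "\<dots> \<le> norm (restrict_rows (S j) w) * norm (?T u)"
    by (rule Cauchy_Schwarz_ineq2)
  also have "\<dots> \<le> norm (restrict_rows (S j) w) * (L * norm u)"
    by (intro mult_left_mono T) simp
  finally show ?thesis by (simp add: mult_ac)
qed

text \<open>
  This is what the step size is for: \<open>2 L m a\<^sub>k\<close> is the square root of \<open>1 + \<sigma> A\<^sub>k\<^sub>-\<^sub>1 / \<gamma>\<close>, so
  Young's inequality splits the product into half of the available strong convexity and a
  quarter of the squared dual step.
\<close>

lemma cross_term_bound:
  assumes js: "js \<in> {1..k} \<rightarrow> {1..m}"
  shows "\<bar>real m * a k * (dual_step js k \<bullet> (A *v u))\<bar>
    \<le> (\<gamma> + \<sigma> * As k) / 4 * (norm u)\<^sup>2 + 1 / 4 * ((norm (dual_step js k))\<^sup>2 / \<gamma>)"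
proof (cases k)
  case 0
  then show ?thesis using gamma_pos by simp
next
  case (Suc n)
  define s where "s = sqrt (1 + \<sigma> * As n / \<gamma>)"
  have s0: "s \<ge> 0" "s\<^sup>2 = 1 + \<sigma> * As n / \<gamma>"
    using sigma_nonneg gamma_pos step_sum_nonneg[of n] by (simp_all add: s_def)
  have s: "\<gamma> * s\<^sup>2 \<le> \<gamma> + \<sigma> * As k"
  proof -
    have "\<gamma> * s\<^sup>2 = \<gamma> + \<sigma> * As n" using gamma_pos by (simp add: s0 field_simps)
    moreover have "As n \<le> As k"
      using step_size_pos[of k] unfolding Suc step_Suc(2) by linarith
    ultimately show ?thesis using sigma_nonneg mult_left_mono[of "As n" "As k" \<sigma>] by linarith
  qed
  have ma: "real m * a k * L = s / 2"
    using m_pos block_norm_pos by (simp add: Suc step_Suc(1) s_def field_simps)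
  have "\<bar>dual_step js k \<bullet> (A *v u)\<bar> \<le> L * norm (dual_step js k) * norm u"
  proof -
    define \<kappa> where "\<kappa> = \<gamma> * real m * a k"
    let ?w = "restrict_rows (S (js k)) (residual js k)"
    have dual_step: "dual_step js k = \<kappa> *\<^sub>R ?w" unfolding Suc dual_step_Suc \<kappa>_def ..
    have "\<bar>\<kappa>\<bar> * \<bar>?w \<bullet> (A *v u)\<bar> \<le> \<bar>\<kappa>\<bar> * (L * norm ?w * norm u)"
      using js Suc by (intro mult_left_mono inner_block_bound) auto
    then show ?thesis by (simp add: dual_step abs_mult mult_ac)
  qed
  then have "(real m * a k) * \<bar>dual_step js k \<bullet> (A *v u)\<bar>
      \<le> (real m * a k) * (L * norm (dual_step js k) * norm u)"
    using step_size_pos[of k] by (intro mult_left_mono) auto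
  also have "\<dots> = (real m * a k * L) * (norm (dual_step js k) * norm u)" by simp
  also have "\<dots> = s * norm (dual_step js k) * norm u / 2" by (simp add: ma)
  also have "\<dots> \<le> \<gamma> * s\<^sup>2 / 4 * (norm u)\<^sup>2 + 1 / 4 * ((norm (dual_step js k))\<^sup>2 / \<gamma>)"
  proof -
    \<comment> \<open>Young's inequality with the weight \<open>\<gamma> * s\<close>\<close>
    have "0 \<le> (\<gamma> * s * norm u - norm (dual_step js k))\<^sup>2" by simp
    then show ?thesis using gamma_pos by (simp add: field_simps power2_eq_square)
  qed
  also have "\<gamma> * s\<^sup>2 / 4 * (norm u)\<^sup>2 \<le> (\<gamma> + \<sigma> * As k) / 4 * (norm u)\<^sup>2"
    using s by (intro mult_right_mono) auto
  finally show ?thesis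
    using step_size_pos[of k] by (simp add: abs_mult)
qed

text \<open>
  The dual step is a multiple of the residual restricted to the sampled block.
\<close>

lemma dual_step_inner_residual: "real m * a k * (dual_step js k \<bullet> residual js k) = (norm (dual_step js k))\<^sup>2 / \<gamma>"
proof (cases k)
  case 0
  then show ?thesis by simp
next
  case (Suc n)
  show ?thesis
    using gamma_pos inner_restrict_rows[of "S (js k)" "residual js k" "residual js k"]
    unfolding Suc dual_step_Suc power2_norm_eq_inner by (simp add: field_simps)
qed

section \<open>The inequality along one run\<close>

definition "noise js k = a k *\<^sub>R residual js k - (1 / \<gamma>) *\<^sub>R dual_step js k"

definition "gap js k v = f (x js k) - f xs + residual js k \<bullet> v"

text \<open>
  The minimum of the estimate function, normalised by the linear and \<open>r\<close> parts of its value at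
  \<open>xs\<close>. Its increments dominate the weighted gaps up to noise and dual terms, and comparing the
  minimum with the value at \<open>xs\<close> bounds it.
\<close>

definition "potential js k = linear_part js k \<bullet> (x js k - xs) + As k * (r (x js k) - r xs)
    + \<gamma> / 2 * (norm (x js k - x0))\<^sup>2"

text \<open>
  Moving from \<open>x\<^sub>k\<close> to the next iterate costs the strong convexity of the old estimate function.
  Replacing the extrapolated dual iterate by \<open>v\<close> in its linear part leaves three terms: the
  noise, the product of the dual step with \<open>v - y\<^sub>k\<close>, expanded by the three-point identity, and
  the extrapolation, which contributes the negated square of the previous dual step and a cross
  term.
\<close>

lemma gap_step:
  assumes js: "js \<in> {1..k} \<rightarrow> {1..m}"
  shows "a (Suc k) * gap js (Suc k) v \<le> potential js (Suc k) - potential js k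
    + noise js (Suc k) \<bullet> (v - y js k)
    + ((norm (v - y js k))\<^sup>2 / \<gamma> - (norm (v - y js (Suc k)))\<^sup>2 / \<gamma>) / 2
    + 1 / 2 * ((norm (dual_step js (Suc k)))\<^sup>2 / \<gamma>) - 3 / 4 * ((norm (dual_step js k))\<^sup>2 / \<gamma>)"
proof -
  let ?x = "x js k" and ?x' = "x js (Suc k)" and ?g = "residual js (Suc k)"
  let ?\<Delta> = "dual_step js k" and ?\<Delta>' = "dual_step js (Suc k)"
  have linear_part: "linear_part js (Suc k) \<bullet> (?x' - xs) = linear_part js k \<bullet> (?x' - xs)
      + a (Suc k) * (y js k \<bullet> ?g + c \<bullet> (?x' - xs)) + real m * a k * (?\<Delta> \<bullet> ?g)"
    unfolding linear_part_Suc residual_eq by (simp add: inner_add_left transpose_inner del: transpose_matrix_vector)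
  have "linear_part js k \<bullet> ?x + As k * r ?x + \<gamma> / 2 * (norm (?x - x0))\<^sup>2
      + (\<gamma> + \<sigma> * As k) / 2 * (norm (?x' - ?x))\<^sup>2
      \<le> linear_part js k \<bullet> ?x' + As k * r ?x' + \<gamma> / 2 * (norm (?x' - x0))\<^sup>2"
    using x_minimises by blast
  then have primal: "potential js k + (\<gamma> + \<sigma> * As k) / 2 * (norm (?x' - ?x))\<^sup>2
      + a (Suc k) * (y js k \<bullet> ?g + (f ?x' - f xs)) + real m * a k * (?\<Delta> \<bullet> ?g) \<le> potential js (Suc k)"
    unfolding potential_def linear_part step_Suc(2) by (simp add: inner_diff_right algebra_simps)
  have "?\<Delta> \<bullet> ?g = ?\<Delta> \<bullet> residual js k + ?\<Delta> \<bullet> (A *v (?x' - ?x))"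
    by (simp add: matrix_vector_mult_diff_distrib inner_diff_right)
  then have "real m * a k * (?\<Delta> \<bullet> ?g)
      = (norm ?\<Delta>)\<^sup>2 / \<gamma> + real m * a k * (?\<Delta> \<bullet> (A *v (?x' - ?x)))"
    by (simp add: distrib_left dual_step_inner_residual)
  with cross_term_bound[OF js, of "?x' - ?x"]
  have extra: "- (real m * a k * (?\<Delta> \<bullet> ?g))
      \<le> (\<gamma> + \<sigma> * As k) / 4 * (norm (?x' - ?x))\<^sup>2 - 3 / 4 * ((norm ?\<Delta>)\<^sup>2 / \<gamma>)"
    by linarith
  have "(norm (v - y js (Suc k)))\<^sup>2 = (norm (v - y js k))\<^sup>2 - 2 * (?\<Delta>' \<bullet> (v - y js k)) + (norm ?\<Delta>')\<^sup>2"
    unfolding power2_norm_eq_inner dual_step_def by (simp add: algebra_simps inner_commute)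
  then have "1 / \<gamma> * (?\<Delta>' \<bullet> (v - y js k))
      = ((norm (v - y js k))\<^sup>2 / \<gamma> - (norm (v - y js (Suc k)))\<^sup>2 / \<gamma>) / 2 + 1 / 2 * ((norm ?\<Delta>')\<^sup>2 / \<gamma>)"
    using gamma_pos by (simp add: field_simps)
  moreover have "noise js (Suc k) \<bullet> (v - y js k)
      = a (Suc k) * (?g \<bullet> (v - y js k)) - 1 / \<gamma> * (?\<Delta>' \<bullet> (v - y js k))"
    by (simp add: noise_def inner_diff_left)
  moreover have "a (Suc k) * gap js (Suc k) v
      = a (Suc k) * (y js k \<bullet> ?g + (f ?x' - f xs)) + a (Suc k) * (?g \<bullet> (v - y js k))"
    unfolding gap_def by (simp add: inner_diff_right algebra_simps inner_commute)
  moreover have "0 \<le> (\<gamma> + \<sigma> * As k) / 4 * (norm (?x' - ?x))\<^sup>2"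
    using gamma_pos sigma_nonneg step_sum_nonneg[of k] by simp
  ultimately show ?thesis using primal extra unfolding distrib_left right_diff_distrib by linarith
qed

text \<open>
  The coefficient \<open>3 / 4\<close> of the last step is exactly what the next application of \<open>gap_step\<close>
  consumes.
\<close>

lemma gap_sum_step:
  assumes "js \<in> {1..k} \<rightarrow> {1..m}"
  shows "(\<Sum>i=1..k. a i * gap js i v) \<le> potential js k + (\<Sum>i=1..k. noise js i \<bullet> (v - y js (i - 1)))
    + ((norm (v - y0))\<^sup>2 / \<gamma> - (norm (v - y js k))\<^sup>2 / \<gamma>) / 2
    - 1 / 4 * ((\<Sum>i=1..k. (norm (dual_step js i))\<^sup>2) / \<gamma>) + 3 / 4 * ((norm (dual_step js k))\<^sup>2 / \<gamma>)"
  using assms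
proof (induction k)
  case 0
  then show ?case by (simp add: potential_def linear_part_def init)
next
  case (Suc k)
  then have js: "js \<in> {1..k} \<rightarrow> {1..m}" by auto
  show ?case
  proof -
    have e1: "(\<Sum>i=1..Suc k. (norm (dual_step js i))\<^sup>2) / \<gamma>
        = (\<Sum>i=1..k. (norm (dual_step js i))\<^sup>2) / \<gamma> + (norm (dual_step js (Suc k)))\<^sup>2 / \<gamma>"
      by (simp add: add_divide_distrib)
    have e2: "(\<Sum>i=1..Suc k. a i * gap js i v)
        = (\<Sum>i=1..k. a i * gap js i v) + a (Suc k) * gap js (Suc k) v" by simp
    have e3: "(\<Sum>i=1..Suc k. noise js i \<bullet> (v - y js (i - 1)))
        = (\<Sum>i=1..k. noise js i \<bullet> (v - y js (i - 1))) + noise js (Suc k) \<bullet> (v - y js k)"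
      by simp
    have telescope: "p + p' \<le> h' + (n + n') + (N\<^sub>0 - N') / 2 - 1 / 4 * (e + e') + 3 / 4 * e'"
      if "p \<le> h + n + (N\<^sub>0 - N) / 2 - 1 / 4 * e + 3 / 4 * e\<^sub>k"
        and "p' \<le> h' - h + n' + (N - N') / 2 + 1 / 2 * e' - 3 / 4 * e\<^sub>k"
      for p p' h h' n n' N\<^sub>0 N N' e e' e\<^sub>k :: real
      using that by argo
    show ?thesis
      unfolding e1 e2 e3 by (rule telescope[OF Suc.IH[OF js] gap_step[OF js]])
  qed
qed

text \<open>
  The strong convexity left at \<open>xs\<close> absorbs the last dual step, whose product with the residual
  is a cross term because \<open>xs\<close> is feasible.
\<close>

lemma pathwise_gap_bound:
  assumes js: "js \<in> {1..k} \<rightarrow> {1..m}"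
  shows "(\<Sum>i=1..k. a i * gap js i v) \<le> \<gamma> / 2 * (norm (xs - x0))\<^sup>2 + 1 / (2 * \<gamma>) * (norm (v - y0))\<^sup>2
    + (\<Sum>i=1..k. noise js i \<bullet> (v - y js (i - 1))) - 1 / (4 * \<gamma>) * (\<Sum>i=1..k. (norm (dual_step js i))\<^sup>2)"
proof -
  have half: "1 / (2 * \<gamma>) * N = 1 / 2 * (N / \<gamma>)"
    and quarter: "1 / (4 * \<gamma>) * N = 1 / 4 * (N / \<gamma>)" for N by simp_all
  have "potential js k + (\<gamma> + \<sigma> * As k) / 2 * (norm (xs - x js k))\<^sup>2 \<le> \<gamma> / 2 * (norm (xs - x0))\<^sup>2"
    using x_minimises(2)[OF xs_in, of js k]
    unfolding potential_def inner_diff_right right_diff_distrib by linarith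
  moreover have "(norm (dual_step js k))\<^sup>2 / \<gamma>
      \<le> (\<gamma> + \<sigma> * As k) / 4 * (norm (xs - x js k))\<^sup>2 + 1 / 4 * ((norm (dual_step js k))\<^sup>2 / \<gamma>)"
    using cross_term_bound[OF js, of "x js k - xs"] dual_step_inner_residual[of k js]
    unfolding residual_eq norm_minus_commute[of xs] by linarith
  moreover have "0 \<le> (\<gamma> + \<sigma> * As k) / 4 * (norm (xs - x js k))\<^sup>2"
    using gamma_pos sigma_nonneg step_sum_nonneg[of k] by simp
  ultimately have last: "potential js k + 3 / 4 * ((norm (dual_step js k))\<^sup>2 / \<gamma>) \<le> \<gamma> / 2 * (norm (xs - x0))\<^sup>2"
    by linarith
  have combine: "p \<le> X' + 1 / 2 * N\<^sub>0 + n - 1 / 4 * e"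
    if "p \<le> h' + n + (N\<^sub>0 - N) / 2 - 1 / 4 * e + 3 / 4 * e\<^sub>k" "h' + 3 / 4 * e\<^sub>k \<le> X'" "0 \<le> N"
    for p h' n N\<^sub>0 N e e\<^sub>k X' :: real
    using that by argo
  have "0 \<le> (norm (v - y js k))\<^sup>2 / \<gamma>"
    using gamma_pos by simp
  then show ?thesis
    unfolding half quarter by (rule combine[OF gap_sum_step[OF js] last])
qed

section \<open>Martingale estimates for the sampling noise\<close>

definition "noise_sum js k = (\<Sum>i=1..k. noise js i)"

lemma iterates_upd:
  assumes "k < n"
  shows "x (js(n := j)) k = x js k" "y (js(n := j)) k = y js k" "q (js(n := j)) k = q js k"
proof -
  have "clvr X c A b r \<sigma> \<gamma> m S x0 y0 (js(n := j)) k = clvr X c A b r \<sigma> \<gamma> m S x0 y0 js k"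
    using assms by (intro clvr_cong) auto
  then show "x (js(n := j)) k = x js k" "y (js(n := j)) k = y js k" "q (js(n := j)) k = q js k"
    by (simp_all add: x_def y_def q_def)
qed

lemma dual_step_noise_upd:
  assumes "k < n"
  shows "dual_step (js(n := j)) k = dual_step js k" "noise (js(n := j)) k = noise js k"
  using assms by (auto simp: dual_step_def noise_def iterates_upd)

text \<open>
  The primal iterate is computed before the block of its iteration is drawn.
\<close>

lemma x_Suc_upd: "x (js(Suc k := j)) (Suc k) = x js (Suc k)"
  unfolding x_Suc by (simp add: iterates_upd)

lemma noise_upd:
  "noise (js(Suc k := j)) (Suc k)
    = a (Suc k) *\<^sub>R residual js (Suc k) - (1 / \<gamma>) *\<^sub>R dual_step (js(Suc k := j)) (Suc k)"
  unfolding noise_def x_Suc_upd ..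

lemma sum_dual_step_upd:
  "(\<Sum>j=1..m. (1 / \<gamma>) *\<^sub>R dual_step (js(Suc k := j)) (Suc k)) = real m *\<^sub>R (a (Suc k) *\<^sub>R residual js (Suc k))"
proof -
  have "(\<Sum>j=1..m. (1 / \<gamma>) *\<^sub>R dual_step (js(Suc k := j)) (Suc k))
      = (real m * a (Suc k)) *\<^sub>R (\<Sum>j=1..m. restrict_rows (S j) (residual js (Suc k)))"
    using gamma_pos by (simp add: dual_step_Suc x_Suc_upd scaleR_sum_right mult.assoc)
  then show ?thesis
    by (simp only: sum_restrict_rows_partition[OF blocks_disjoint blocks_cover] scaleR_scaleR)
qed

lemma sum_noise_upd: "(\<Sum>j=1..m. noise (js(Suc k := j)) (Suc k)) = 0"
  unfolding noise_upd sum_subtractf sum_dual_step_upd sum_constant_scaleR by simp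

text \<open>
  The noise of an iteration has mean zero given the past, while \<open>y\<^sub>i\<^sub>-\<^sub>1\<close> is determined by the
  past.
\<close>

lemma mean_noise_inner:
  "draws_mean m k (\<lambda>js. \<Sum>i=1..k. noise js i \<bullet> (w - y js (i - 1))) = 0"
proof (induction k)
  case 0
  show ?case by (simp add: draws_mean_def)
next
  case (Suc k)
  have "(\<Sum>j=1..m. \<Sum>i=1..Suc k. noise (js(Suc k := j)) i \<bullet> (w - y (js(Suc k := j)) (i - 1)))
        / real m = (\<Sum>i=1..k. noise js i \<bullet> (w - y js (i - 1)))" for js
  proof -
    have y_upd: "y (js(Suc k := j)) (i - Suc 0) = y js (i - Suc 0)" if "i \<le> k" for i j
      using that by (intro iterates_upd) simp
    have "(\<Sum>i=1..Suc k. noise (js(Suc k := j)) i \<bullet> (w - y (js(Suc k := j)) (i - 1)))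
        = (\<Sum>i=1..k. noise js i \<bullet> (w - y js (i - 1)))
          + noise (js(Suc k := j)) (Suc k) \<bullet> (w - y js k)" for j
      by (simp add: dual_step_noise_upd iterates_upd y_upd)
    then have "(\<Sum>j=1..m. \<Sum>i=1..Suc k. noise (js(Suc k := j)) i \<bullet> (w - y (js(Suc k := j)) (i - 1)))
        = real m * (\<Sum>i=1..k. noise js i \<bullet> (w - y js (i - 1)))
          + (\<Sum>j=1..m. noise (js(Suc k := j)) (Suc k)) \<bullet> (w - y js k)"
      by (simp only: sum.distrib inner_sum_left) simp
    then show ?thesis unfolding sum_noise_upd using m_pos by simp
  qed
  then show ?case unfolding draws_mean_Suc using Suc.IH by simp
qed

text \<open>
  Martingale differences are orthogonal, so their variances add up; each is at most the second
  moment of the uncentred estimate, which is the scaled dual step.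
\<close>

lemma mean_noise_square_le:
  "draws_mean m k (\<lambda>js. (norm (noise_sum js k))\<^sup>2)
    \<le> 1 / \<gamma>\<^sup>2 * draws_mean m k (\<lambda>js. \<Sum>i=1..k. (norm (dual_step js i))\<^sup>2)"
proof -
  have "draws_mean m k (\<lambda>js. (norm (noise_sum js k))\<^sup>2
      - 1 / \<gamma>\<^sup>2 * (\<Sum>i=1..k. (norm (dual_step js i))\<^sup>2)) \<le> 0"
  proof (induction k)
    case 0
    show ?case by (simp add: draws_mean_def noise_sum_def)
  next
    case (Suc k)
    have "(\<Sum>j=1..m. (norm (noise_sum (js(Suc k := j)) (Suc k)))\<^sup>2
          - 1 / \<gamma>\<^sup>2 * (\<Sum>i=1..Suc k. (norm (dual_step (js(Suc k := j)) i))\<^sup>2)) / real m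
        \<le> (norm (noise_sum js k))\<^sup>2 - 1 / \<gamma>\<^sup>2 * (\<Sum>i=1..k. (norm (dual_step js i))\<^sup>2)"
      (is "?lhs / _ \<le> ?N - ?V") for js
    proof -
      define u where "u = a (Suc k) *\<^sub>R residual js (Suc k)"
      define d where "d j = (1 / \<gamma>) *\<^sub>R dual_step (js(Suc k := j)) (Suc k)" for j
      have N: "noise_sum (js(Suc k := j)) (Suc k) = noise_sum js k + (u - d j)" for j
        unfolding noise_sum_def u_def d_def noise_upd[symmetric] by (simp add: dual_step_noise_upd)
      have V: "1 / \<gamma>\<^sup>2 * (\<Sum>i=1..Suc k. (norm (dual_step (js(Suc k := j)) i))\<^sup>2) = ?V + (norm (d j))\<^sup>2" for j
        unfolding d_def using gamma_pos
        by (simp add: dual_step_noise_upd field_simps)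
      have "(\<Sum>j=1..m. d j) = real (card {1..m}) *\<^sub>R u"
        unfolding u_def d_def sum_dual_step_upd by simp
      from sum_norm_centred_le[OF this, of "noise_sum js k"]
      have "?lhs \<le> real m * (?N - ?V)"
        unfolding N V by (simp add: sum.distrib sum_subtractf algebra_simps)
      then show ?thesis using m_pos by (simp add: field_simps)
    qed
    then have "draws_mean m (Suc k) (\<lambda>js. (norm (noise_sum js (Suc k)))\<^sup>2
          - 1 / \<gamma>\<^sup>2 * (\<Sum>i=1..Suc k. (norm (dual_step js i))\<^sup>2))
        \<le> draws_mean m k (\<lambda>js. (norm (noise_sum js k))\<^sup>2
          - 1 / \<gamma>\<^sup>2 * (\<Sum>i=1..k. (norm (dual_step js i))\<^sup>2))"
      unfolding draws_mean_Suc by (intro draws_mean_mono) blast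
    with Suc.IH show ?case by simp
  qed
  then show ?thesis unfolding draws_mean_linear by simp
qed

section \<open>The primal-dual gap of the averaged iterate\<close>

abbreviation "xt js k \<equiv> clvr_average X c A b r \<sigma> \<gamma> m S x0 y0 js k"

definition "avg_gap js k v = f (xt js k) - f xs + (A *v xt js k - b) \<bullet> v"

lemma xt_convex_combination:
  assumes "k \<ge> 1"
  shows "xt js k = (\<Sum>i=1..k. (a i / As k) *\<^sub>R x js i)"
    and "(\<Sum>i=1..k. a i / As k) = 1" and "\<And>i. 0 \<le> a i / As k"
proof -
  show "xt js k = (\<Sum>i=1..k. (a i / As k) *\<^sub>R x js i)"
    unfolding clvr_average_def x_def by (simp add: scaleR_sum_right)
  have "As k \<noteq> 0" using step_sum_pos[OF assms] by simp
  then show "(\<Sum>i=1..k. a i / As k) = 1"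
    by (simp add: step_sum_eq flip: sum_divide_distrib)
  show "0 \<le> a i / As k" for i
    using step_size_pos[of i] step_sum_nonneg[of k] by simp
qed

lemma xt_in:
  assumes "k \<ge> 1"
  shows "xt js k \<in> X"
proof -
  note comb = xt_convex_combination[OF assms]
  show ?thesis
    unfolding comb(1) using comb(2,3) x_minimises(1) convex_X by (intro convex_sum) auto
qed

text \<open>
  Jensen's inequality for \<open>r\<close>; everything else in the gap is affine in the iterate.
\<close>

lemma avg_gap_le:
  assumes "k \<ge> 1"
  shows "As k * avg_gap js k v \<le> (\<Sum>i=1..k. a i * gap js i v)"
proof -
  note comb = xt_convex_combination[OF assms]
  have "r (xt js k) \<le> (\<Sum>i=1..k. a i / As k * r (x js i))"
    unfolding comb(1) using comb(2,3) assms by (intro convex_on_sum[OF _ _ convex_r]) auto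
  then have "avg_gap js k v
      \<le> (\<Sum>i=1..k. a i / As k * r (x js i)) + c \<bullet> xt js k - f xs + (A *v xt js k - b) \<bullet> v"
    unfolding avg_gap_def by simp
  also have "\<dots> = (\<Sum>i=1..k. a i / As k * gap js i v)"
  proof -
    have cx: "c \<bullet> xt js k = (\<Sum>i=1..k. a i / As k * (c \<bullet> x js i))"
      unfolding comb(1) by (simp add: inner_sum_right)
    have Ax: "(A *v xt js k - b) \<bullet> v = (\<Sum>i=1..k. a i / As k * (residual js i \<bullet> v))"
    proof -
      have "A *v xt js k - b = (\<Sum>i=1..k. (a i / As k) *\<^sub>R (A *v x js i)) - (\<Sum>i=1..k. a i / As k) *\<^sub>R b"
        unfolding comb(1) comb(2)
        by (simp add: linear_sum[OF matrix_vector_mul_linear] matrix_vector_mult_scaleR)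
      also have "\<dots> = (\<Sum>i=1..k. (a i / As k) *\<^sub>R residual js i)"
        by (simp add: scaleR_sum_left scaleR_diff_right sum_subtractf)
      finally show ?thesis by (simp add: inner_sum_left)
    qed
    have fx: "f xs = (\<Sum>i=1..k. a i / As k * f xs)"
      unfolding sum_distrib_right[symmetric] comb(2) by simp
    have "a i / As k * gap js i v = a i / As k * r (x js i) + a i / As k * (c \<bullet> x js i)
        - a i / As k * f xs + a i / As k * (residual js i \<bullet> v)" for i
      unfolding gap_def by (simp only: distrib_left right_diff_distrib)
    then have "(\<Sum>i=1..k. a i / As k * gap js i v) = (\<Sum>i=1..k. a i / As k * r (x js i))
        + c \<bullet> xt js k - f xs + (A *v xt js k - b) \<bullet> v"
      unfolding cx Ax by (subst fx) (simp only: sum.distrib sum_subtractf)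
    then show ?thesis by simp
  qed
  finally have "As k * avg_gap js k v \<le> As k * (\<Sum>i=1..k. a i / As k * gap js i v)"
    using step_sum_nonneg by (rule mult_left_mono)
  also have "\<dots> = (\<Sum>i=1..k. a i * gap js i v)"
    using step_sum_pos[OF assms] by (simp add: sum_distrib_left)
  finally show ?thesis .
qed

lemma saddle_gap_nonneg: "k \<ge> 1 \<Longrightarrow> 0 \<le> avg_gap js k ys"
  using xs_optimal[OF xt_in, of k js] unfolding avg_gap_def by (simp add: inner_commute)

lemma avg_gap_pathwise:
  assumes "k \<ge> 1" and "js \<in> PiE {1..k} (\<lambda>_. {1..m})"
  shows "As k * avg_gap js k v \<le> \<gamma> / 2 * (norm (xs - x0))\<^sup>2 + 1 / (2 * \<gamma>) * (norm (v - y0))\<^sup>2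
    + (\<Sum>i=1..k. noise js i \<bullet> (v - y js (i - 1))) - 1 / (4 * \<gamma>) * (\<Sum>i=1..k. (norm (dual_step js i))\<^sup>2)"
proof -
  have "js \<in> {1..k} \<rightarrow> {1..m}" using assms(2) by auto
  then show ?thesis
    using avg_gap_le[OF assms(1), of js v] pathwise_gap_bound[of js k v] by linarith
qed

text \<open>
  Against the fixed comparator \<open>ys\<close> the noise averages out and the gap is nonnegative, so the
  negative quadratic term of the pathwise bound cannot exceed the initial distances.
\<close>

lemma mean_dual_movement_le:
  assumes "k \<ge> 1"
  shows "1 / (4 * \<gamma>) * draws_mean m k (\<lambda>js. \<Sum>i=1..k. (norm (dual_step js i))\<^sup>2)
    \<le> \<gamma> / 2 * (norm (xs - x0))\<^sup>2 + 1 / (2 * \<gamma>) * (norm (ys - y0))\<^sup>2"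
proof -
  let ?C = "\<gamma> / 2 * (norm (xs - x0))\<^sup>2 + 1 / (2 * \<gamma>) * (norm (ys - y0))\<^sup>2"
  have "draws_mean m k (\<lambda>js. 1 / (4 * \<gamma>) * (\<Sum>i=1..k. (norm (dual_step js i))\<^sup>2))
      \<le> draws_mean m k (\<lambda>js. ?C + (\<Sum>i=1..k. noise js i \<bullet> (ys - y js (i - 1))))"
  proof (rule draws_mean_mono)
    fix js assume js: "js \<in> PiE {1..k} (\<lambda>_. {1..m})"
    have "0 \<le> As k * avg_gap js k ys"
      using saddle_gap_nonneg[OF assms] step_sum_nonneg by (rule mult_nonneg_nonneg[rotated])
    then show "1 / (4 * \<gamma>) * (\<Sum>i=1..k. (norm (dual_step js i))\<^sup>2)
        \<le> ?C + (\<Sum>i=1..k. noise js i \<bullet> (ys - y js (i - 1)))"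
      using avg_gap_pathwise[OF assms js, of ys] by linarith
  qed
  then show ?thesis
    unfolding draws_mean_linear mean_noise_inner draws_mean_const[OF m_pos] by simp
qed

text \<open>
  The comparator may depend on the whole run, so it is correlated with the noise. Only the part
  that is linear in \<open>V - y0\<close> is affected; the remainder is a martingale with the fixed
  comparator \<open>y0\<close>. The noise part of Young's inequality costs \<open>1 / (2 * \<gamma>)\<close> times the mean dual
  movement, half of which the negative term of the pathwise bound cancels and the other half of
  which is bounded by the initial distances.
\<close>

lemma mean_avg_gap_le:
  assumes "k \<ge> 1"
  shows "As k * draws_mean m k (\<lambda>js. avg_gap js k (V js))
    \<le> \<gamma> * (norm (xs - x0))\<^sup>2 + 1 / (2 * \<gamma>) * (norm (ys - y0))\<^sup>2
      + 1 / \<gamma> * draws_mean m k (\<lambda>js. (norm (V js - y0))\<^sup>2)"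
proof -
  let ?I = "\<lambda>js. \<Sum>i=1..k. (norm (dual_step js i))\<^sup>2"
  let ?Z = "\<lambda>js. \<Sum>i=1..k. noise js i \<bullet> (y0 - y js (i - 1))"
  have "draws_mean m k (\<lambda>js. As k * avg_gap js k (V js))
      \<le> draws_mean m k (\<lambda>js. \<gamma> / 2 * (norm (xs - x0))\<^sup>2 + 1 / \<gamma> * (norm (V js - y0))\<^sup>2
          + \<gamma> / 2 * (norm (noise_sum js k))\<^sup>2 + ?Z js - 1 / (4 * \<gamma>) * ?I js)"
  proof (rule draws_mean_mono)
    fix js assume js: "js \<in> PiE {1..k} (\<lambda>_. {1..m})"
    have "(\<Sum>i=1..k. noise js i \<bullet> (V js - y js (i - 1))) = noise_sum js k \<bullet> (V js - y0) + ?Z js"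
      unfolding noise_sum_def inner_sum_left sum.distrib[symmetric]
      by (simp flip: inner_add_right)
    moreover have "noise_sum js k \<bullet> (V js - y0)
        \<le> \<gamma> / 2 * (norm (noise_sum js k))\<^sup>2 + 1 / (2 * \<gamma>) * (norm (V js - y0))\<^sup>2"
    proof -
      have "0 \<le> (norm (\<gamma> *\<^sub>R noise_sum js k - (V js - y0)))\<^sup>2" by simp
      also have "\<dots> = \<gamma>\<^sup>2 * (norm (noise_sum js k))\<^sup>2 - 2 * \<gamma> * (noise_sum js k \<bullet> (V js - y0))
          + (norm (V js - y0))\<^sup>2"
        unfolding power2_norm_eq_inner inner_diff_left[of "\<gamma> *\<^sub>R noise_sum js k"]
          inner_diff_right[of _ "\<gamma> *\<^sub>R noise_sum js k"]
        by (simp add: inner_commute power2_eq_square algebra_simps)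
      finally show ?thesis using gamma_pos by (simp add: field_simps power2_eq_square)
    qed
    moreover have "1 / (2 * \<gamma>) * (norm (V js - y0))\<^sup>2 + 1 / (2 * \<gamma>) * (norm (V js - y0))\<^sup>2
        = 1 / \<gamma> * (norm (V js - y0))\<^sup>2" by simp
    ultimately show "As k * avg_gap js k (V js) \<le> \<gamma> / 2 * (norm (xs - x0))\<^sup>2
        + 1 / \<gamma> * (norm (V js - y0))\<^sup>2 + \<gamma> / 2 * (norm (noise_sum js k))\<^sup>2
        + ?Z js - 1 / (4 * \<gamma>) * ?I js"
      using avg_gap_pathwise[OF assms js, of "V js"] by linarith
  qed
  then have "As k * draws_mean m k (\<lambda>js. avg_gap js k (V js))
      \<le> \<gamma> / 2 * (norm (xs - x0))\<^sup>2 + 1 / \<gamma> * draws_mean m k (\<lambda>js. (norm (V js - y0))\<^sup>2)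
        + \<gamma> / 2 * draws_mean m k (\<lambda>js. (norm (noise_sum js k))\<^sup>2)
        - 1 / (4 * \<gamma>) * draws_mean m k ?I"
    unfolding draws_mean_linear mean_noise_inner draws_mean_const[OF m_pos] by simp
  moreover have "\<gamma> / 2 * draws_mean m k (\<lambda>js. (norm (noise_sum js k))\<^sup>2)
      \<le> \<gamma> / 2 * (1 / \<gamma>\<^sup>2 * draws_mean m k ?I)"
    using mean_noise_square_le gamma_pos by (intro mult_left_mono) auto
  moreover have "\<gamma> / 2 * (1 / \<gamma>\<^sup>2 * draws_mean m k ?I) = 2 * (1 / (4 * \<gamma>) * draws_mean m k ?I)"
    using gamma_pos by (simp add: field_simps power2_eq_square)
  ultimately show ?thesis
    using mean_dual_movement_le[OF assms] by linarith
qed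

text \<open>
  The factor \<open>2\<close> in the comparator pays once for the negative part of the suboptimality and
  leaves one copy of \<open>norm ys\<close> times the residual.
\<close>

lemma dual_comparator_gap:
  fixes js k
  defines "v \<equiv> dual_comparator A b ys (xt js k)"
  assumes "k \<ge> 1"
  shows "norm ys * norm (A *v xt js k - b) \<le> avg_gap js k v"
    and "f (xt js k) - f xs \<le> avg_gap js k v"
    and "- (f (xt js k) - f xs) \<le> norm ys * norm (A *v xt js k - b)"
proof -
  let ?g = "A *v xt js k - b"
  have gv: "?g \<bullet> v = 2 * (norm ys * norm ?g)"
    by (simp add: v_def dual_comparator_def dot_square_norm power2_eq_square)
  have "?g \<bullet> ys \<le> norm ?g * norm ys"
    by (rule norm_cauchy_schwarz)
  then show low: "- (f (xt js k) - f xs) \<le> norm ys * norm ?g"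
    using saddle_gap_nonneg[OF assms(2), of js] unfolding avg_gap_def by (simp add: mult.commute)
  then show "norm ys * norm ?g \<le> avg_gap js k v" and "f (xt js k) - f xs \<le> avg_gap js k v"
    unfolding avg_gap_def gv by (simp_all add: mult_nonneg_nonneg)
qed

end

theorem corollary1:
  fixes X :: "(real^'d) set" and c :: "real^'d" and A :: "real^'d^'n" and b :: "real^'n"
    and r :: "real^'d \<Rightarrow> real" and \<sigma> \<gamma> :: real
    and m :: nat and S :: "nat \<Rightarrow> 'n set"
    and x0 xs :: "real^'d" and y0 ys :: "real^'n"
    and M :: "'w measure" and J :: "nat \<Rightarrow> 'w \<Rightarrow> nat" and k K :: nat
  assumes "closed X" and "convex X"
    and "convex_on UNIV r"
    and "\<sigma> \<ge> 0" and "strongly_convex_on X r \<sigma>"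
    and "\<And>j. j \<in> {1..m} \<Longrightarrow> S j \<noteq> {}"
    and "disjoint_family_on S {1..m}"
    and "(\<Union>j\<in>{1..m}. S j) = UNIV"
    and "max_block_norm A m S > 0"
    and "nash_point X c A b r xs ys"
    and "x0 \<in> X" and "\<gamma> > 0"
    and "prob_space M"
    and "prob_space.indep_vars M (\<lambda>_. count_space UNIV) J {1..K}"
    and "\<And>i. i \<in> {1..K} \<Longrightarrow>
           distr M (count_space UNIV) (J i) = measure_pmf (pmf_of_set {1..m})"
    and "1 \<le> k" and "k \<le> K"
  shows "let xt = (\<lambda>\<omega>. clvr_average X c A b r \<sigma> \<gamma> m S x0 y0 (\<lambda>i. J i \<omega>) k);
             v = (\<lambda>\<omega>. dual_comparator A b ys (xt \<omega>));
             Ak = step_sum (max_block_norm A m S) m \<sigma> \<gamma> k;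
             bound = (\<gamma> * (norm (xs - x0))\<^sup>2 + 1 / (2 * \<gamma>) * (norm (ys - y0))\<^sup>2
               + 1 / \<gamma> * (\<integral>\<omega>. (norm (v \<omega> - y0))\<^sup>2 \<partial>M)) / Ak
         in (\<integral>\<omega>. norm ys * norm (A *v xt \<omega> - b) \<partial>M) \<le> bound \<and>
            \<bar>\<integral>\<omega>. (c \<bullet> xt \<omega> + r (xt \<omega>)) - (c \<bullet> xs + r xs) \<partial>M\<bar> \<le> bound"
proof -
  interpret prob_space M by fact
  interpret clvr_problem X c A b r \<sigma> \<gamma> m S x0 xs y0 ys
    using assms by unfold_locales
  let ?E = "draws_mean m k"
  let ?v = "\<lambda>js. dual_comparator A b ys (xt js k)"
  have dep: "xt js k = xt js' k" if "\<And>i. i \<in> {1..k} \<Longrightarrow> js i = js' i" for js js'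
  proof -
    have "clvr X c A b r \<sigma> \<gamma> m S x0 y0 js i = clvr X c A b r \<sigma> \<gamma> m S x0 y0 js' i"
      if "i \<in> {1..k}" for i
      using that \<open>\<And>i. i \<in> {1..k} \<Longrightarrow> js i = js' i\<close> by (intro clvr_cong) auto
    then have "(\<Sum>i=1..k. a i *\<^sub>R fst (clvr X c A b r \<sigma> \<gamma> m S x0 y0 js i))
        = (\<Sum>i=1..k. a i *\<^sub>R fst (clvr X c A b r \<sigma> \<gamma> m S x0 y0 js' i))"
      by (intro sum.cong refl) simp
    then show ?thesis unfolding clvr_average_def by (rule arg_cong)
  qed
  have transfer: "(\<integral>\<omega>. G (xt (\<lambda>i. J i \<omega>) k) \<partial>M) = ?E (\<lambda>js. G (xt js k))"
    for G :: "real^'d \<Rightarrow> real"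
    using assms(14,15,16,17) m_pos arg_cong[OF dep, of _ _ G]
    by (rule expectation_eq_draws_mean[where F = "\<lambda>js. G (xt js k)"])
  define bound where "bound = (\<gamma> * (norm (xs - x0))\<^sup>2 + 1 / (2 * \<gamma>) * (norm (ys - y0))\<^sup>2
      + 1 / \<gamma> * ?E (\<lambda>js. (norm (?v js - y0))\<^sup>2)) / As k"
  have gap: "?E (\<lambda>js. avg_gap js k (?v js)) \<le> bound"
    using mean_avg_gap_le[OF assms(16), of ?v] step_sum_pos[OF assms(16)]
    unfolding bound_def by (simp add: pos_le_divide_eq mult.commute)
  note cmp = dual_comparator_gap[OF assms(16)]
  have 1: "?E (\<lambda>js. norm ys * norm (A *v xt js k - b)) \<le> bound"
    using draws_mean_mono[OF cmp(1)] gap by (rule order_trans)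
  have 2: "?E (\<lambda>js. f (xt js k) - f xs) \<le> bound"
    using draws_mean_mono[OF cmp(2)] gap by (rule order_trans)
  have "?E (\<lambda>js. (-1) * (f (xt js k) - f xs)) \<le> ?E (\<lambda>js. norm ys * norm (A *v xt js k - b))"
    using cmp(3) by (intro draws_mean_mono) simp
  with 1 have 3: "- ?E (\<lambda>js. f (xt js k) - f xs) \<le> bound"
    unfolding draws_mean_linear(3) by simp
  have "(\<integral>\<omega>. norm ys * norm (A *v xt (\<lambda>i. J i \<omega>) k - b) \<partial>M) \<le> bound"
    unfolding transfer[of "\<lambda>u. norm ys * norm (A *v u - b)"] by (rule 1)
  moreover have "\<bar>\<integral>\<omega>. f (xt (\<lambda>i. J i \<omega>) k) - f xs \<partial>M\<bar> \<le> bound"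
    unfolding transfer[of "\<lambda>u. f u - f xs"] using 2 3 by (intro abs_leI)
  moreover have "bound = (\<gamma> * (norm (xs - x0))\<^sup>2 + 1 / (2 * \<gamma>) * (norm (ys - y0))\<^sup>2
      + 1 / \<gamma> * (\<integral>\<omega>. (norm (?v (\<lambda>i. J i \<omega>) - y0))\<^sup>2 \<partial>M)) / As k"
    unfolding bound_def transfer[of "\<lambda>u. (norm (dual_comparator A b ys u - y0))\<^sup>2"] ..
  ultimately show ?thesis unfolding Let_def by simp
qed

end
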